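(* Let $F$ be a field of characteristic not $2$ and let $R$ be a unital commutative associative $F$-algebra which is a unique factorization domain. Let $X=\begin{pmatrix}X_1&X_2\\ X_3&-X_1\end{pmatrix}\in\mathfrak{sl}_2(R)$. Then the following two conditions are equivalent. (1) $X_1^2+X_2X_3=0$ and $(X_2)+(X_3)=R$. (2) There is $P\in GL_2(R)$ such that $P^{-1}XP=\begin{pmatrix}0&1\\ 0&0\end{pmatrix}$.
   Context: $\mathfrak{sl}_2(R)$ denotes the set of $2\times 2$ matrices $\begin{pmatrix}a&b\\ c&-a\end{pmatrix}$ with $a,b,c\in R$. $GL_2(R)$ is the group of $2\times 2$ matrices over $R$ whose determinant is a unit of $R$. For $r\in R$, $(r)$ denotes the principal ideal of $R$ generated by $r$. *)

theory Defs
  imports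
    "HOL-Analysis.Determinants"
    "Berlekamp_Zassenhaus.Unique_Factorization"
begin

text \<open>
  The ring \<open>R\<close> is a type of class \<^class>\<open>ufd\<close>: an integral domain in which every nonzero
  nonunit is a product of irreducibles, uniquely up to order and associates. No normalisation
  function on the ring is fixed, in contrast to the class of factorial semirings.
\<close>

text \<open>
  Multiplication and its unit come from the class of the ring, so only the scalar action is
  a parameter. By commutativity a single compatibility law makes the product bilinear.
\<close>

locale comm_algebra = vector_space scale
  for scale :: "'f::field \<Rightarrow> 'r::comm_ring_1 \<Rightarrow> 'r" +
  assumes scale_mult_left: "scale c x * y = scale c (x * y)"

definition mat2 :: "'r \<Rightarrow> 'r \<Rightarrow> 'r \<Rightarrow> 'r \<Rightarrow> 'r::zero^2^2" where
  "mat2 a b c d = vector [vector [a, b], vector [c, d]]"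

definition sl2 :: "('r::comm_ring_1^2^2) set" where
  "sl2 = {mat2 a b c (- a) |a b c. True}"

definition GL2 :: "('r::comm_ring_1^2^2) set" where
  "GL2 = {P. det P dvd 1}"

definition principal_ideal :: "'r::comm_ring_1 \<Rightarrow> 'r set" where
  "principal_ideal r = {a * r |a. True}"

definition ideal_sum :: "'r::comm_ring_1 set \<Rightarrow> 'r set \<Rightarrow> 'r set" where
  "ideal_sum I J = {x + y |x y. x \<in> I \<and> y \<in> J}"

lemma mat2_nth [simp]:
  "mat2 a b c d $ 1 $ 1 = a" "mat2 a b c d $ 1 $ 2 = b"
  "mat2 a b c d $ 2 $ 1 = c" "mat2 a b c d $ 2 $ 2 = d"
  by (simp_all add: mat2_def)

text \<open>
  The function \<^const>\<open>matrix_inv\<close> is a choice operator, meaningful only where a two-sided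
  inverse exists; the next two facts show that on \<^const>\<open>GL2\<close> it is the inverse.
\<close>

lemma GL2_iff_invertible: "P \<in> GL2 \<longleftrightarrow> invertible P"
proof
  assume "P \<in> GL2"
  then obtain u where u: "det P * u = 1"
    unfolding GL2_def dvd_def by auto
  have d: "(P$1$1 * P$2$2 - P$1$2 * P$2$1) * u = 1"
    using u by (simp add: det_2)
  let ?Q = "mat2 (P$2$2 * u) (- (P$1$2 * u)) (- (P$2$1 * u)) (P$1$1 * u)"
  have "P ** ?Q = mat 1" "?Q ** P = mat 1"
    using d by (simp_all add: vec_eq_iff forall_2 matrix_matrix_mult_def sum_2 mat_def
        algebra_simps)
  then show "invertible P"
    unfolding invertible_def by blast
next
  assume "invertible P"
  then obtain Q where "P ** Q = mat 1"
    unfolding invertible_def by blast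
  then have "det P * det Q = 1"
    by (metis det_mul det_I)
  then show "P \<in> GL2"
    unfolding GL2_def by (metis dvdI mem_Collect_eq)
qed

lemma GL2_matrix_inv:
  assumes "P \<in> GL2"
  shows "P ** matrix_inv P = mat 1" "matrix_inv P ** P = mat 1"
proof -
  have "\<exists>Q. P ** Q = mat 1 \<and> Q ** P = mat 1"
    using assms by (simp add: GL2_iff_invertible invertible_def)
  then have "P ** matrix_inv P = mat 1 \<and> matrix_inv P ** P = mat 1"
    unfolding matrix_inv_def by (rule someI_ex)
  then show "P ** matrix_inv P = mat 1" "matrix_inv P ** P = mat 1"
    by blast+
qed

end

theory Submission
  imports Defs
begin

text \<open>
  The equation \<open>X\<^sub>1\<^sup>2 + X\<^sub>2 X\<^sub>3 = 0\<close> says that \<open>X\<close> is singular, so over the field of fractions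
  it is a column times a row. Unique factorization, in the form of gcds, makes this integral and
  symmetric: \<open>X = u (a, - c)\<^sup>T (c, a)\<close>, which is \<open>nilpotent_entries_factor\<close>. If
  \<open>X\<^sub>2 = u a\<^sup>2\<close> and \<open>X\<^sub>3 = - u c\<^sup>2\<close> generate the unit ideal, say
  \<open>s X\<^sub>2 + t X\<^sub>3 = 1\<close>, then \<open>u\<close> is a unit. The vector \<open>(a, - c)\<close> is in the kernel of \<open>X\<close>, and
  \<open>X\<close> maps \<open>(- t c, s a)\<close> to it; the matrix with these two columns has determinant
  \<open>s a\<^sup>2 - t c\<^sup>2\<close>, the inverse of \<open>u\<close>.

  Conversely, let \<open>N\<close> be the matrix in the second condition, \<open>p\<close> and \<open>r\<close> the entries of the
  first column of \<open>P\<close>, and \<open>d\<close> its determinant. Computing \<open>X = P N P\<^sup>-\<^sup>1\<close> with the adjugate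
  gives \<open>d X\<^sub>1 = - p r\<close>, \<open>d X\<^sub>2 = p\<^sup>2\<close> and \<open>d X\<^sub>3 = - r\<^sup>2\<close>. The unit \<open>d\<close> lies in the ideal
  generated by \<open>p\<close> and \<open>r\<close>, so its cube lies in the one generated by \<open>p\<^sup>2\<close> and \<open>r\<^sup>2\<close>.
\<close>

text \<open>
  Both \<open>a c\<close> and \<open>b c\<close> are multiples of \<open>a\<close>, hence so is their gcd, which is a unit times \<open>c\<close>.
\<close>

lemma coprime_dvd_mult_cancel:
  fixes a b c :: "'r::ufd"
  assumes "coprime a b" and "a dvd b * c"
  shows "a dvd c"
proof -
  have "a dvd some_gcd a b * c"
    using assms(2) by (intro some_gcd.gcd_greatest_mult) auto
  moreover have "some_gcd a b dvd 1"
    using assms(1) some_gcd.gcd_dvd_1 by blast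
  ultimately show ?thesis
    by (metis dvd_trans mult_dvd_mono dvd_refl mult_1)
qed

lemma gcd_cofactors_exist:
  fixes x y :: "'r::ufd"
  assumes "x \<noteq> 0 \<or> y \<noteq> 0"
  obtains g a b where "g \<noteq> 0" "x = g * a" "y = g * b" "coprime a b"
proof -
  define g where "g = some_gcd x y"
  obtain a b where ab: "x = g * a" "y = g * b"
    unfolding g_def by (meson dvdE some_gcd.gcd_dvd1 some_gcd.gcd_dvd2)
  have g: "g \<noteq> 0"
    using assms ab by auto
  have "coprime a b"
  proof (rule coprimeI)
    fix r assume "r dvd a" "r dvd b"
    then have "g * r dvd x" "g * r dvd y"
      using ab by (simp_all add: mult_dvd_mono)
    then have "g * r dvd g"
      unfolding g_def by (rule some_gcd.gcd_greatest)
    then have "g * r dvd g * 1"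
      by simp
    then show "r dvd 1"
      using g by simp
  qed
  with g ab that show thesis
    by blast
qed

text \<open>
  Divide \<open>x\<close> and \<open>y\<close> by their gcd \<open>g\<close>, so that \<open>x = g c\<close> and \<open>y = g a\<close>. Then
  \<open>g c\<^sup>2 = - a z\<close>, and since \<open>a\<close> is coprime to \<open>c\<close> it divides \<open>g\<close>; the quotient is \<open>u\<close>.
\<close>

lemma nilpotent_entries_factor:
  fixes x y z :: "'r::ufd"
  assumes "x\<^sup>2 + y * z = 0"
  obtains u a c where "x = u * a * c" "y = u * a\<^sup>2" "z = - (u * c\<^sup>2)"
proof (cases "x = 0 \<and> y = 0")
  case True
  then show thesis
    by (intro that[of "- z" 0 1]) auto
next
  case False
  then obtain g a c where g: "g \<noteq> 0" and xy: "y = g * a" "x = g * c" and cop: "coprime a c"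
    using gcd_cofactors_exist[of y x] by blast
  have "g * (g * c\<^sup>2 + a * z) = 0"
    using assms xy by (simp add: power2_eq_square algebra_simps)
  then have eq: "g * c\<^sup>2 + a * z = 0"
    using g by simp
  then have "c * (c * g) = a * (- z)"
    by (simp add: power2_eq_square algebra_simps eq_neg_iff_add_eq_0)
  then have "a dvd c * (c * g)"
    by simp
  then have "a dvd g"
    using coprime_dvd_mult_cancel[OF cop] by blast
  then obtain u where u: "g = a * u" ..
  have a: "a \<noteq> 0"
    using g u by auto
  have "a * (u * c\<^sup>2 + z) = 0"
    using eq u by (simp add: algebra_simps)
  then have "z = - (u * c\<^sup>2)"
    using a by (simp add: eq_neg_iff_add_eq_0 add.commute)
  with xy u show thesis
    by (intro that[of u a c]) (simp_all add: power2_eq_square algebra_simps)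
qed

lemma principal_ideals_sum_UNIV_iff:
  "ideal_sum (principal_ideal x) (principal_ideal y) = UNIV \<longleftrightarrow> (\<exists>s t. s * x + t * y = 1)"
proof
  assume "ideal_sum (principal_ideal x) (principal_ideal y) = UNIV"
  then have "1 \<in> ideal_sum (principal_ideal x) (principal_ideal y)"
    by simp
  then show "\<exists>s t. s * x + t * y = 1"
    unfolding ideal_sum_def principal_ideal_def by auto
next
  assume "\<exists>s t. s * x + t * y = 1"
  then obtain s t where st: "s * x + t * y = 1"
    by blast
  have "w \<in> ideal_sum (principal_ideal x) (principal_ideal y)" for w
  proof -
    have "w = (w * s) * x + (w * t) * y"
      using st by (metis distrib_left mult.assoc mult.right_neutral)
    then show ?thesis
      unfolding ideal_sum_def principal_ideal_def by blast
  qed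
  then show "ideal_sum (principal_ideal x) (principal_ideal y) = UNIV"
    by blast
qed

lemma conjugate_eq_iff:
  assumes "P \<in> GL2"
  shows "matrix_inv P ** X ** P = N \<longleftrightarrow> X ** P = P ** N"
  by (metis GL2_matrix_inv[OF assms] matrix_mul_assoc matrix_mul_lid)

lemma mat2_eta: "P = mat2 (P$1$1) (P$1$2) (P$2$1) (P$2$2)"
  by (simp add: vec_eq_iff forall_2)

lemma mat2_eq_iff:
  "mat2 a b c d = mat2 a' b' c' d' \<longleftrightarrow> a = a' \<and> b = b' \<and> c = c' \<and> d = d'"
  by (metis mat2_nth)

lemma mat2_mult:
  fixes a :: "'r::comm_ring_1"
  shows "mat2 a b c d ** mat2 a' b' c' d' =
    mat2 (a * a' + b * c') (a * b' + b * d') (c * a' + d * c') (c * b' + d * d')"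
  by (simp add: vec_eq_iff forall_2 matrix_matrix_mult_def sum_2)

lemma det_mat2: "det (mat2 a b c d) = a * d - b * c"
  by (simp add: det_2)

lemma conjugate_to_nilpotent_block:
  fixes x y z :: "'r::ufd"
  assumes "x\<^sup>2 + y * z = 0" and st: "s * y + t * z = 1"
  shows "\<exists>P \<in> GL2. mat2 x y z (- x) ** P = P ** mat2 0 1 0 0"
proof -
  obtain u a c where uac: "x = u * a * c" "y = u * a\<^sup>2" "z = - (u * c\<^sup>2)"
    using nilpotent_entries_factor[OF assms(1)] .
  \<comment> \<open>The first column spans the kernel. The second is mapped to the first because the row
    \<open>(c, a)\<close> takes the value \<open>s a\<^sup>2 - t c\<^sup>2\<close> on it, and this is the inverse of \<open>u\<close>.\<close>
  define P where "P = mat2 a (- (t * c)) (- c) (s * a)"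
  have unit: "(s * a\<^sup>2 - t * c\<^sup>2) * u = 1"
    using st uac by (simp add: algebra_simps)
  have det: "det P = s * a\<^sup>2 - t * c\<^sup>2"
    by (simp add: P_def det_mat2 power2_eq_square algebra_simps)
  have "P \<in> GL2"
    unfolding GL2_def using det unit by (metis dvdI mem_Collect_eq)
  moreover have "mat2 x y z (- x) ** P = P ** mat2 0 1 0 0"
  proof -
    have "x * (- (t * c)) + y * (s * a) = a" "z * (- (t * c)) + (- x) * (s * a) = - c"
      using unit uac by algebra+
    then show ?thesis
      using uac
      by (simp add: P_def mat2_mult mat2_eq_iff power2_eq_square algebra_simps)
  qed
  ultimately show ?thesis
    by blast
qed

lemma conjugate_of_nilpotent_block:
  fixes x y z :: "'r::comm_ring_1"
  assumes "P \<in> GL2" and "mat2 x y z (- x) ** P = P ** mat2 0 1 0 0"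
  shows "x\<^sup>2 + y * z = 0" and "\<exists>s t. s * y + t * z = 1"
proof -
  obtain p q r w where P: "P = mat2 p q r w"
    using mat2_eta by blast
  obtain v where v: "(p * w - q * r) * v = 1"
    using assms(1) unfolding GL2_def P by (auto simp: det_mat2 elim: dvdE)
  have eqs: "x * p + y * r = 0" "x * q + y * w = p" "z * p - x * r = 0" "z * q - x * w = r"
    using assms(2) unfolding P by (simp_all add: mat2_mult mat2_eq_iff)
  \<comment> \<open>Cramer's rule for the two rows of the matrix equation.\<close>
  let ?d = "p * w - q * r"
  have "?d * x = w * (x * p + y * r) - r * (x * q + y * w)"
    "?d * y = p * (x * q + y * w) - q * (x * p + y * r)"
    "?d * z = w * (z * p - x * r) - r * (z * q - x * w)"
    by (simp_all add: algebra_simps)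
  then have "?d * x = - (p * r)" "?d * y = p\<^sup>2" "?d * z = - r\<^sup>2"
    unfolding eqs by (simp_all add: power2_eq_square mult.commute)
  moreover have "e = ?d * e * v" for e
    using v by (metis mult.assoc mult.commute mult_1)
  ultimately have entries: "x = - (p * r * v)" "y = p\<^sup>2 * v" "z = - (r\<^sup>2 * v)"
    by (metis mult_minus_left)+
  then show "x\<^sup>2 + y * z = 0"
    by (simp add: power2_eq_square algebra_simps)
  \<comment> \<open>The coefficients come from expanding \<open>((p w - q r) v)\<^sup>3\<close>: every term contains
    \<open>p\<^sup>2\<close> or \<open>r\<^sup>2\<close>.\<close>
  have "((p * w ^ 3 - 3 * w\<^sup>2 * q * r) * v\<^sup>2) * y + ((q ^ 3 * r - 3 * p * w * q\<^sup>2) * v\<^sup>2) * z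
      = ((p * w - q * r) * v) ^ 3"
    unfolding entries by (simp add: power2_eq_square power3_eq_cube algebra_simps)
  then show "\<exists>s t. s * y + t * z = 1"
    using v by auto
qed

theorem corollary8:
  fixes scale :: "'f::field \<Rightarrow> 'r::ufd \<Rightarrow> 'r"
    and X :: "'r^2^2" and X1 X2 X3 :: 'r
  assumes "CHAR('f) \<noteq> 2"
    and "comm_algebra scale"
    and "X \<in> sl2"
    and "X = mat2 X1 X2 X3 (- X1)"
  shows "(X1\<^sup>2 + X2 * X3 = 0 \<and>
          ideal_sum (principal_ideal X2) (principal_ideal X3) = UNIV) \<longleftrightarrow>
         (\<exists>P \<in> GL2. matrix_inv P ** X ** P = mat2 0 1 0 0)"
proof -
  have "(\<exists>P \<in> GL2. matrix_inv P ** X ** P = mat2 0 1 0 0) \<longleftrightarrow>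
      (\<exists>P \<in> GL2. mat2 X1 X2 X3 (- X1) ** P = P ** mat2 0 1 0 0)"
    using conjugate_eq_iff assms(4) by blast
  then show ?thesis
    unfolding principal_ideals_sum_UNIV_iff
    using conjugate_to_nilpotent_block conjugate_of_nilpotent_block by blast
qed

end
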